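(* For each $n>0$ and all proper $\alpha_1,\dots,\alpha_n,\beta,\gamma\in2^\omega$ we have \[ s_\beta\times s_\gamma\not\le_W s^{\oplus_n}_{\alpha_1,\dots,\alpha_n}. \]
   Context: Cantor space $2^\omega$ carries the lexicographic order $<_{lex}$. For $\alpha\in2^\omega$, $s_\alpha\colon 2^\omega\to\{0,1\}$ is $s_\alpha(x)=0$ if $x<_{lex}\alpha$ and $s_\alpha(x)=1$ if $x\ge_{lex}\alpha$. A sequence is proper if it contains infinitely many $1$'s. $s^{\oplus_{n}}_{\alpha_1,\dots,\alpha_n}\colon(2^\omega)^n\to\{0,1\}$ is $(x_1,\dots,x_n)\mapsto s_{\alpha_1}(x_1)\oplus\dots\oplus s_{\alpha_n}(x_n)$ ($\oplus$ = addition modulo 2). $(s_\beta\times s_\gamma)(x,y)=(s_\beta(x),s_\gamma(y))$. $f\le_W g$ means there are computable functionals $\Phi,\Psi$ with $f(x)=\Psi(x,g(\Phi(x)))$ for all $x$ in the domain of $f$. *)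

theory Defs
  imports Main "HOL-Library.Fun_Lexorder"
begin

section \<open>Functions computable relative to an oracle\<close>

text \<open>
  Points of Cantor space are functions of type \<open>nat \<Rightarrow> bool\<close>, with \<open>True\<close> for the digit 1.
  Computability of functionals on Cantor space is Kleene's: mu-recursive programs with access to
  an oracle.
\<close>

type_synonym cantor = "nat \<Rightarrow> bool"

datatype prog =
    Zero
  | Succ
  | Proj nat
  | Oracle
  | Comp prog "prog list"
  | PrimRec prog prog
  | Mu prog

text \<open>
  \<open>evaluates p e xs z\<close>: with oracle \<open>p\<close>, program \<open>e\<close> halts on the arguments \<open>xs\<close> with value \<open>z\<close>.
\<close>

inductive evaluates :: "cantor \<Rightarrow> prog \<Rightarrow> nat list \<Rightarrow> nat \<Rightarrow> bool" for p :: cantor where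
  Zero: "evaluates p Zero xs 0"
| Succ: "evaluates p Succ (x # xs) (Suc x)"
| Proj: "i < length xs \<Longrightarrow> evaluates p (Proj i) xs (xs ! i)"
| Oracle: "evaluates p Oracle (x # xs) (of_bool (p x))"
| Comp: "list_all2 (\<lambda>g y. evaluates p g xs y) gs ys \<Longrightarrow> evaluates p f ys z
    \<Longrightarrow> evaluates p (Comp f gs) xs z"
| PrimRec_0: "evaluates p f xs z \<Longrightarrow> evaluates p (PrimRec f g) (0 # xs) z"
| PrimRec_Suc: "evaluates p (PrimRec f g) (n # xs) r \<Longrightarrow> evaluates p g (n # r # xs) z
    \<Longrightarrow> evaluates p (PrimRec f g) (Suc n # xs) z"
| Mu: "evaluates p f (n # xs) 0 \<Longrightarrow> \<forall>m<n. \<exists>k. evaluates p f (m # xs) (Suc k)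
    \<Longrightarrow> evaluates p (Mu f) xs n"

definition computes :: "prog \<Rightarrow> cantor \<Rightarrow> cantor \<Rightarrow> bool" where
  "computes e p q \<longleftrightarrow> (\<forall>n. evaluates p e [n] (of_bool (q n)))"


section \<open>Represented spaces and Weihrauch reducibility\<close>

text \<open>
  Functionals also take and return bits and tuples, so these are coded as points of Cantor space
  in the usual way: a representation is a partial map assigning to a name the point it names.
  A bit is named by any sequence that starts with it; tuples are coded by interleaving names.
\<close>

type_synonym 'a repr = "cantor \<rightharpoonup> 'a"

definition cantor_repr :: "cantor repr" where
  "cantor_repr p = Some p"

definition bool_repr :: "bool repr" where
  "bool_repr p = Some (p 0)"

definition prod_repr :: "'a repr \<Rightarrow> 'b repr \<Rightarrow> ('a \<times> 'b) repr" where
  "prod_repr \<rho> \<sigma> p =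
    (case (\<rho> (\<lambda>k. p (2 * k)), \<sigma> (\<lambda>k. p (2 * k + 1))) of
      (Some x, Some y) \<Rightarrow> Some (x, y)
    | _ \<Rightarrow> None)"

text \<open>The \<open>n\<close>-th power of a space consists of the lists of length \<open>n\<close>.\<close>

definition power_repr :: "nat \<Rightarrow> 'a repr \<Rightarrow> 'a list repr" where
  "power_repr n \<rho> p = those (map (\<lambda>i. \<rho> (\<lambda>k. p (n * k + i))) [0..<n])"

definition computable_map :: "'a repr \<Rightarrow> 'b repr \<Rightarrow> ('a \<rightharpoonup> 'b) \<Rightarrow> bool" where
  "computable_map \<rho> \<sigma> F \<longleftrightarrow>
    (\<exists>e. \<forall>p x y. \<rho> p = Some x \<longrightarrow> F x = Some y \<longrightarrow> (\<exists>q. computes e p q \<and> \<sigma> q = Some y))"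

definition weihrauch_le ::
  "'a repr \<Rightarrow> 'b repr \<Rightarrow> 'c repr \<Rightarrow> 'd repr \<Rightarrow> ('a \<rightharpoonup> 'b) \<Rightarrow> ('c \<rightharpoonup> 'd) \<Rightarrow> bool" where
  "weihrauch_le \<rho>\<^sub>a \<rho>\<^sub>b \<rho>\<^sub>c \<rho>\<^sub>d f g \<longleftrightarrow>
    (\<exists>\<Phi> \<Psi>. computable_map \<rho>\<^sub>a \<rho>\<^sub>c \<Phi> \<and> computable_map (prod_repr \<rho>\<^sub>a \<rho>\<^sub>d) \<rho>\<^sub>b \<Psi> \<and>
      (\<forall>x y. f x = Some y \<longrightarrow>
        (\<exists>z w. \<Phi> x = Some z \<and> g z = Some w \<and> \<Psi> (x, w) = Some y)))"


section \<open>Threshold functions\<close>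

definition proper :: "cantor \<Rightarrow> bool" where
  "proper \<alpha> \<longleftrightarrow> infinite {n. \<alpha> n}"

text \<open>\<open>less_fun\<close> is the strict lexicographic order, which is linear on \<open>cantor\<close>.\<close>

definition threshold :: "cantor \<Rightarrow> cantor \<Rightarrow> bool" where
  "threshold \<alpha> x \<longleftrightarrow> \<not> less_fun x \<alpha>"

definition threshold_sum :: "cantor list \<Rightarrow> cantor list \<rightharpoonup> bool" where
  "threshold_sum \<alpha>s xs =
    (if length xs = length \<alpha>s
     then Some (odd (\<Sum>i<length \<alpha>s. of_bool (threshold (\<alpha>s ! i) (xs ! i)) :: nat))
     else None)"

end

(*
  By continuity alone, no single bit of advice determines the pair of threshold values; neither
  the inner functional nor the parity matters.  Let b be the bit returned at (\<beta>, \<gamma>), where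
  the value is (1, 1).  The computation of this value from b reads finitely many digits, so all
  nearby instances with another value get the bit \<not> b.  As \<beta> is proper, one of them is (x, \<gamma>)
  with x < \<beta> and value (0, 1).  In turn all instances near (x, \<gamma>) with bit \<not> b have value
  (0, 1); but as \<gamma> is proper, there is y < \<gamma> close to \<gamma>, and (x, y) has bit \<not> b and
  value (0, 0).
*)

theory Submission
  imports Defs
begin

text \<open>\<open>computes\<close> is a relation; determinism is what turns a computation found for
  a nearby oracle into equality of output digits.\<close>

lemma evaluates_deterministic:
  assumes "evaluates p e xs z" and "evaluates p e xs z'"
  shows "z = z'"
  using assms
proof (induction arbitrary: z' rule: evaluates.induct)
  case (Comp xs gs ys f z)
  from Comp.prems obtain ys' where ys': "list_all2 (\<lambda>g y. evaluates p g xs y) gs ys'"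
    and f: "evaluates p f ys' z'"
    by (cases rule: evaluates.cases) auto
  have "ys = ys'"
    using Comp.IH(1) ys' by (auto simp: list_all2_conv_all_nth intro!: nth_equalityI)
  then show ?case
    using Comp.IH(2) f by blast
next
  case (PrimRec_0 f xs z g)
  from PrimRec_0.prems show ?case
    by (cases rule: evaluates.cases) (auto dest: PrimRec_0.IH)
next
  case (PrimRec_Suc f g n xs r z)
  from PrimRec_Suc.prems show ?case
    by (cases rule: evaluates.cases) (auto dest!: PrimRec_Suc.IH(1) PrimRec_Suc.IH(2))
next
  case (Mu f n xs)
  from Mu.prems have z': "evaluates p f (z' # xs) 0"
    and below: "\<forall>m<z'. \<exists>k. evaluates p f (m # xs) (Suc k)"
    by (cases rule: evaluates.cases; simp)+
  \<comment> \<open>Each of the two searches sees a positive value below its result, where the other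
    would see 0.\<close>
  have "\<not> z' < n"
    using Mu.IH(2) z' by (metis nat.distinct(1))
  moreover have "\<not> n < z'"
    using Mu.IH(1) below by (metis nat.distinct(1))
  ultimately show ?case
    by simp
qed (erule evaluates.cases; simp)+

definition agree_below :: "nat \<Rightarrow> cantor \<Rightarrow> cantor \<Rightarrow> bool" where
  "agree_below N p q \<longleftrightarrow> (\<forall>k<N. p k = q k)"

lemma agree_below_refl [simp]: "agree_below N p p"
  by (simp add: agree_below_def)

text \<open>The neighbourhood filter of \<open>p\<close> in the product topology of Cantor
  space.\<close>

definition near :: "cantor \<Rightarrow> (cantor \<Rightarrow> bool) \<Rightarrow> bool" where
  "near p P \<longleftrightarrow> (\<exists>N. \<forall>q. agree_below N p q \<longrightarrow> P q)"

lemma near_mono: "near p P \<Longrightarrow> (\<And>q. P q \<Longrightarrow> Q q) \<Longrightarrow> near p Q"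
  by (auto simp: near_def)

lemma near_conj:
  assumes "near p P" and "near p Q"
  shows "near p (\<lambda>q. P q \<and> Q q)"
proof -
  from assms obtain M N where "\<forall>q. agree_below M p q \<longrightarrow> P q" and "\<forall>q. agree_below N p q \<longrightarrow> Q q"
    by (auto simp: near_def)
  then show ?thesis
    unfolding near_def by (intro exI[of _ "max M N"]) (auto simp: agree_below_def)
qed

lemma near_all_less:
  fixes n :: nat
  shows "(\<And>m. m < n \<Longrightarrow> near p (P m)) \<Longrightarrow> near p (\<lambda>q. \<forall>m<n. P m q)"
proof (induction n)
  case 0
  then show ?case
    by (simp add: near_def)
next
  case (Suc n)
  then have "near p (\<lambda>q. (\<forall>m<n. P m q) \<and> P n q)"
    by (intro near_conj) auto
  then show ?case
    by (rule near_mono) (auto simp: less_Suc_eq)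
qed

text \<open>A halting run makes finitely many oracle queries. Each rule combines finitely many
  subruns, so finitely many neighbourhoods are intersected; for \<open>Mu\<close> these include the
  failed tests below \<open>n\<close>.\<close>

lemma evaluates_near: "evaluates p e xs z \<Longrightarrow> near p (\<lambda>q. evaluates q e xs z)"
proof (induction rule: evaluates.induct)
  case (Oracle x xs)
  show ?case
    unfolding near_def
  proof (intro exI[of _ "Suc x"] allI impI)
    fix q
    assume "agree_below (Suc x) p q"
    then have "p x = q x"
      by (simp add: agree_below_def)
    then show "evaluates q Oracle (x # xs) (of_bool (p x))"
      by (simp add: evaluates.Oracle)
  qed
next
  case (Comp xs gs ys f z)
  have "near p (\<lambda>q. \<forall>i<length gs. evaluates q (gs ! i) xs (ys ! i))"
    using Comp.IH(1) by (intro near_all_less) (auto simp: list_all2_conv_all_nth)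
  then have "near p (\<lambda>q. (\<forall>i<length gs. evaluates q (gs ! i) xs (ys ! i)) \<and> evaluates q f ys z)"
    using Comp.IH(2) by (rule near_conj)
  then show ?case
    by (rule near_mono)
      (use Comp.IH(1) in \<open>auto simp: list_all2_conv_all_nth intro!: evaluates.Comp[where ys = ys]\<close>)
next
  case (PrimRec_Suc f g n xs r z)
  from near_conj[OF PrimRec_Suc.IH] show ?case
    by (rule near_mono) (auto intro: evaluates.PrimRec_Suc)
next
  case (Mu f n xs)
  have "near p (\<lambda>q. \<forall>m<n. \<exists>k. evaluates q f (m # xs) (Suc k))"
  proof (rule near_all_less)
    fix m
    assume "m < n"
    with Mu.IH(2) obtain k where "near p (\<lambda>q. evaluates q f (m # xs) (Suc k))"
      by blast
    then show "near p (\<lambda>q. \<exists>k. evaluates q f (m # xs) (Suc k))"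
      by (rule near_mono) blast
  qed
  from near_conj[OF Mu.IH(1) this] show ?case
    by (rule near_mono) (auto intro: evaluates.Mu)
qed (auto simp: near_def intro: evaluates.Zero evaluates.Succ evaluates.Proj evaluates.PrimRec_0)

text \<open>Continuity of each output digit. The program need not be total at \<open>p'\<close>,
  hence the conditional form.\<close>

lemma computes_near:
  assumes "computes e p q"
  shows "near p (\<lambda>p'. \<forall>q'. computes e p' q' \<longrightarrow> q' n = q n)"
proof -
  from assms have "near p (\<lambda>p'. evaluates p' e [n] (of_bool (q n)))"
    by (simp add: computes_def evaluates_near)
  then show ?thesis
  proof (rule near_mono)
    fix p'
    assume *: "evaluates p' e [n] (of_bool (q n))"
    show "\<forall>q'. computes e p' q' \<longrightarrow> q' n = q n"
    proof (intro allI impI)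
      fix q'
      assume "computes e p' q'"
      then have "(of_bool (q' n) :: nat) = of_bool (q n)"
        using * evaluates_deterministic unfolding computes_def by blast
      then show "q' n = q n"
        by (cases "q' n"; cases "q n") simp_all
    qed
  qed
qed

lemma proper_approx_below:
  assumes "proper \<alpha>"
  obtains x where "agree_below N \<alpha> x" and "less_fun x \<alpha>"
proof -
  \<comment> \<open>Erasing a digit 1 at or after position \<open>N\<close> decreases the sequence
    without touching the first \<open>N\<close> digits.\<close>
  from assms obtain k where k: "k \<ge> N" "\<alpha> k"
    by (auto simp: proper_def finite_nat_set_iff_bounded not_less)
  show ?thesis
  proof
    show "agree_below N \<alpha> (\<alpha>(k := False))"
      using k(1) by (auto simp: agree_below_def)
    show "less_fun (\<alpha>(k := False)) \<alpha>"
      using k(2) by (auto simp: less_fun_def)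
  qed
qed

lemma threshold_refl: "threshold \<alpha> \<alpha>"
  by (simp add: threshold_def less_fun_def)

definition interleave :: "cantor \<Rightarrow> cantor \<Rightarrow> cantor" where
  "interleave p q k = (if even k then p (k div 2) else q (k div 2))"

lemma prod_repr_interleave:
  "\<rho> p = Some x \<Longrightarrow> \<sigma> q = Some y \<Longrightarrow> prod_repr \<rho> \<sigma> (interleave p q) = Some (x, y)"
  by (simp add: prod_repr_def interleave_def)

text \<open>The same \<open>N\<close> suffices, as digit \<open>k\<close> comes from position
  \<open>k div 2\<close>, which is at most \<open>k\<close>.\<close>

lemma agree_below_interleave:
  "agree_below N p p' \<Longrightarrow> agree_below N q q' \<Longrightarrow>
    agree_below N (interleave p q) (interleave p' q')"
  by (auto simp: agree_below_def interleave_def)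

lemma bool_repr_prodD:
  "prod_repr bool_repr bool_repr q = Some (c, d) \<Longrightarrow> q 0 = c \<and> q 1 = d"
  by (simp add: prod_repr_def bool_repr_def)

lemma threshold_prod_not_one_bit:
  assumes "proper \<beta>" and "proper \<gamma>"
    and \<Psi>: "computable_map (prod_repr (prod_repr cantor_repr cantor_repr) bool_repr)
      (prod_repr bool_repr bool_repr) \<Psi>"
    and B: "\<And>x y. \<Psi> ((x, y), B x y) = Some (threshold \<beta> x, threshold \<gamma> y)"
  shows False
proof -
  \<comment> \<open>Naming the bit by a constant sequence makes equal bits contribute identical
    halves of the names.\<close>
  define name where "name x y b = interleave (interleave x y) (\<lambda>_. b)" for x y b
  have name: "prod_repr (prod_repr cantor_repr cantor_repr) bool_repr (name x y b)
      = Some ((x, y), b)" for x y b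
    by (simp add: name_def prod_repr_interleave cantor_repr_def bool_repr_def)
  from \<Psi> obtain e where e: "\<And>p v c d.
      prod_repr (prod_repr cantor_repr cantor_repr) bool_repr p = Some v \<Longrightarrow>
      \<Psi> v = Some (c, d) \<Longrightarrow>
      \<exists>q. computes e p q \<and> prod_repr bool_repr bool_repr q = Some (c, d)"
    unfolding computable_map_def by metis
  have realizer: "\<exists>q. computes e (name x y (B x y)) q \<and> q 0 = threshold \<beta> x \<and> q 1 = threshold \<gamma> y"
    for x y
    using e[OF name B, of x y] by (metis bool_repr_prodD)
  \<comment> \<open>\<open>B\<close> itself may be discontinuous, so local constancy is claimed only
    among instances with the same bit.\<close>
  have locally_constant: "\<exists>N. \<forall>x' y'. agree_below N x x' \<longrightarrow> agree_below N y y' \<longrightarrow>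
      B x' y' = B x y \<longrightarrow> threshold \<beta> x' = threshold \<beta> x \<and> threshold \<gamma> y' = threshold \<gamma> y" for x y
  proof -
    obtain q where q: "computes e (name x y (B x y)) q" "q 0 = threshold \<beta> x" "q 1 = threshold \<gamma> y"
      using realizer by blast
    have "near (name x y (B x y)) (\<lambda>p'. (\<forall>q'. computes e p' q' \<longrightarrow> q' 0 = q 0) \<and>
        (\<forall>q'. computes e p' q' \<longrightarrow> q' 1 = q 1))"
      by (intro near_conj computes_near q(1))
    then obtain N where N: "\<And>p' q'. agree_below N (name x y (B x y)) p' \<Longrightarrow> computes e p' q' \<Longrightarrow>
        q' 0 = q 0 \<and> q' 1 = q 1"
      unfolding near_def by blast
    show ?thesis
    proof (intro exI[of _ N] allI impI)
      fix x' y'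
      assume close: "agree_below N x x'" "agree_below N y y'" and bit: "B x' y' = B x y"
      have "agree_below N (name x y (B x y)) (name x' y' (B x' y'))"
        unfolding name_def bit by (intro agree_below_interleave close agree_below_refl)
      then show "threshold \<beta> x' = threshold \<beta> x \<and> threshold \<gamma> y' = threshold \<gamma> y"
        using N realizer[of x' y'] q by metis
    qed
  qed
  obtain M where M: "\<And>x y. agree_below M \<beta> x \<Longrightarrow> agree_below M \<gamma> y \<Longrightarrow> B x y = B \<beta> \<gamma> \<Longrightarrow>
      threshold \<beta> x \<and> threshold \<gamma> y"
    using locally_constant[of \<beta> \<gamma>] by (auto simp: threshold_refl)
  obtain x where x: "agree_below M \<beta> x" "less_fun x \<beta>"
    using proper_approx_below[OF \<open>proper \<beta>\<close>] .
  \<comment> \<open>The first value at \<open>x\<close> is 0, so the bit cannot be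
    \<open>B \<beta> \<gamma>\<close>; this includes the case of \<open>y\<close> being
    \<gamma>.\<close>
  have bit: "B x y = (\<not> B \<beta> \<gamma>)" if "agree_below M \<gamma> y" for y
    using M[OF x(1) that] x(2) by (auto simp: threshold_def)
  obtain N where N: "\<And>y. agree_below N \<gamma> y \<Longrightarrow> B x y = B x \<gamma> \<Longrightarrow> threshold \<gamma> y"
    using locally_constant[of x \<gamma>] agree_below_refl threshold_refl by metis
  \<comment> \<open>Agreement up to \<open>M\<close> forces \<open>B x y = B x \<gamma>\<close> by
    \<open>bit\<close>; agreement up to \<open>N\<close> then lets \<open>N\<close> apply.\<close>
  obtain y where y: "agree_below (max M N) \<gamma> y" "less_fun y \<gamma>"
    using proper_approx_below[OF \<open>proper \<gamma>\<close>] .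
  have "agree_below M \<gamma> y" "agree_below N \<gamma> y"
    using y(1) by (auto simp: agree_below_def)
  then have "threshold \<gamma> y"
    using N bit by simp
  with y(2) show False
    by (simp add: threshold_def)
qed

theorem mainTheorem4:
  fixes n :: nat and \<alpha>s :: "cantor list" and \<beta> \<gamma> :: cantor
  assumes "n > 0"
    and "length \<alpha>s = n"
    and "\<forall>i<n. proper (\<alpha>s ! i)"
    and "proper \<beta>" and "proper \<gamma>"
  shows "\<not> weihrauch_le
      (prod_repr cantor_repr cantor_repr) (prod_repr bool_repr bool_repr)
      (power_repr n cantor_repr) bool_repr
      (Some \<circ> map_prod (threshold \<beta>) (threshold \<gamma>)) (threshold_sum \<alpha>s)"
proof
  assume "weihrauch_le
      (prod_repr cantor_repr cantor_repr) (prod_repr bool_repr bool_repr)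
      (power_repr n cantor_repr) bool_repr
      (Some \<circ> map_prod (threshold \<beta>) (threshold \<gamma>)) (threshold_sum \<alpha>s)"
  \<comment> \<open>The reduced function is total, so every pair receives some bit \<open>w\<close>;
    choice then collects these bits into \<open>B\<close>.\<close>
  then obtain \<Psi> where
    \<Psi>: "computable_map (prod_repr (prod_repr cantor_repr cantor_repr) bool_repr)
      (prod_repr bool_repr bool_repr) \<Psi>"
    and "\<forall>x y. \<exists>w. \<Psi> ((x, y), w) = Some (threshold \<beta> x, threshold \<gamma> y)"
    unfolding weihrauch_le_def by force
  then obtain B where "\<And>x y. \<Psi> ((x, y), B x y) = Some (threshold \<beta> x, threshold \<gamma> y)"
    by metis
  with \<open>proper \<beta>\<close> \<open>proper \<gamma>\<close> \<Psi> show False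
    by (rule threshold_prod_not_one_bit)
qed

end
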